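(* Let $n\ge 1$, $M_\#\in\mathbb{C}^{n\times n}$, $\kappa\in\mathbb{C}$, $b\in\mathbb{C}^n$ and $j\ge 1$. Suppose $M_\#$ is condiagonalizable, i.e. $M_\#=X\Lambda_\#\overline{X^{-1}}$ with $X\in\mathbb{C}^{n\times n}$ invertible and $\Lambda_\#\in\mathbb{C}^{n\times n}$ diagonal. If $D\in\mathbb{C}^{n\times n}$ is a unitary diagonal matrix satisfying $D^{-1}X^{-1}b\in\mathbb{R}^n$, then $$\min_{z\in\mathcal{K}_j(\mathcal{M}_\kappa;b)}\|\mathcal{M}_\kappa z-b\|\le \kappa_2(X)\min_{p\in\mathcal{P}_{j-1}(r2)}\ \max_{\lambda\in\sigma(D_\#)}\left|\kappa\, p(\lambda)+\lambda\,\overline{p(\lambda)}-1\right|\,\|b\|,$$ where $D_\#$ denotes the diagonal matrix $D^{-1}\Lambda_\#\overline{D}$.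
   Context: A bar over a vector or matrix denotes entrywise complex conjugation; $\|\cdot\|$ is the Euclidean norm on $\mathbb{C}^n$ and the induced operator norm on matrices; $\kappa_2(X)=\|X\|\,\|X^{-1}\|$ (not to be confused with the scalar $\kappa$). $\sigma(D_\#)$ is the usual (complex linear) spectrum, i.e. the set of diagonal entries of $D_\#$. $\mathcal{M}_\kappa:\mathbb{C}^n\to\mathbb{C}^n$ is the real linear operator $\mathcal{M}_\kappa z=\kappa z+M_\#\overline{z}$. The Krylov subspace is the complex span $\mathcal{K}_j(\mathcal{M}_\kappa;b)=\mathrm{span}_{\mathbb{C}}\{b,\mathcal{M}_\kappa b,\ldots,\mathcal{M}_\kappa^{j-1}b\}$. For an integer $j\ge 0$, $\mathcal{P}_j(r2)$ is the set of functions of $\lambda\in\mathbb{C}$ of the form $\sum_{k=0}^{\lfloor j/2\rfloor}(\alpha_{2k}+\alpha_{2k+1}\lambda)|\lambda|^{2k}$ with $\alpha_k\in\mathbb{C}$, where $\alpha_{j+1}=0$ if $j$ is even. *)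

theory Defs
  imports "HOL-Analysis.Analysis"
begin

text \<open>
  Vectors in \<open>\<complex>\<^sup>n\<close> have type \<open>complex ^ 'n\<close>; their \<open>norm\<close> is the Euclidean one. The term
  \<open>norm A\<close> for a matrix \<open>A\<close> would be the Frobenius norm, so the operator norm is written
  \<open>onorm ((*v) A)\<close>.
\<close>

abbreviation cnj_vec :: "complex ^ 'n \<Rightarrow> complex ^ 'n" where
  "cnj_vec z \<equiv> (\<chi> i. cnj (z $ i))"

abbreviation cnj_mat :: "complex ^ 'n ^ 'm \<Rightarrow> complex ^ 'n ^ 'm" where
  "cnj_mat A \<equiv> map_matrix cnj A"

definition diagonal_matrix :: "complex ^ 'n ^ 'n \<Rightarrow> bool" where
  "diagonal_matrix A \<longleftrightarrow> (\<forall>i j. i \<noteq> j \<longrightarrow> A $ i $ j = 0)"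

definition unitary_matrix :: "complex ^ 'n ^ 'n \<Rightarrow> bool" where
  "unitary_matrix U \<longleftrightarrow>
     transpose (cnj_mat U) ** U = mat 1 \<and> U ** transpose (cnj_mat U) = mat 1"

definition spectrum :: "complex ^ 'n ^ 'n \<Rightarrow> complex set" where
  "spectrum A = {\<mu>. \<not> invertible (A - mat \<mu>)}"

lemma spectrum_diagonal:
  assumes "diagonal_matrix A"
  shows "spectrum A = range (\<lambda>i. A $ i $ i)"
proof -
  have "det (A - mat x) = (\<Prod>i\<in>UNIV. A $ i $ i - x)" for x
    using assms by (subst det_diagonal) (auto simp: diagonal_matrix_def mat_def)
  then show ?thesis
    by (auto simp: spectrum_def invertible_det_nz)
qed

definition cond2 :: "complex ^ 'n ^ 'n \<Rightarrow> real" where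
  "cond2 X = onorm ((*v) X) * onorm ((*v) (matrix_inv X))"

definition real_lin_op :: "complex \<Rightarrow> complex ^ 'n ^ 'n \<Rightarrow> complex ^ 'n \<Rightarrow> complex ^ 'n" where
  "real_lin_op \<kappa> M z = \<kappa> *s z + M *v cnj_vec z"

text \<open>
  The operator is only real linear, but the span is complex: \<open>vec.span\<close> is the span with respect
  to \<open>(*s)\<close>, here over \<open>complex\<close>, whereas \<open>span\<close> would be the real one.
\<close>

definition krylov :: "nat \<Rightarrow> (complex ^ 'n \<Rightarrow> complex ^ 'n) \<Rightarrow> complex ^ 'n \<Rightarrow> (complex ^ 'n) set" where
  "krylov j T b = vec.span {(T ^^ i) b | i. i < j}"

text \<open>
  Only the coefficients \<open>\<alpha> 0, \<dots>, \<alpha> j\<close> matter: for odd \<open>j\<close> the last index occurring in the sum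
  is \<open>j\<close>, for even \<open>j\<close> it is \<open>j + 1\<close>, whose coefficient is required to vanish.
\<close>

definition polys_r2 :: "nat \<Rightarrow> (complex \<Rightarrow> complex) set" where
  "polys_r2 j =
     {\<lambda>x. \<Sum>k = 0..j div 2. (\<alpha> (2 * k) + \<alpha> (2 * k + 1) * x) * of_real (cmod x ^ (2 * k))
      | \<alpha> :: nat \<Rightarrow> complex. even j \<longrightarrow> \<alpha> (j + 1) = 0}"

end

theory Submission
  imports Defs
begin

text \<open>
  Put \<open>L y = X D y\<close> and \<open>c = D\<^sup>-\<^sup>1 X\<^sup>-\<^sup>1 b\<close>, so that \<open>L c = b\<close>. Conjugation by \<open>L\<close> turns the operator
  into the componentwise map \<open>y\<^sub>i \<mapsto> \<kappa> y\<^sub>i + \<lambda>\<^sub>i cnj y\<^sub>i\<close>, and as \<open>c\<close> is real it sends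
  \<open>p(\<lambda>\<^sub>i) c\<^sub>i\<close> to \<open>(\<kappa> p(\<lambda>\<^sub>i) + \<lambda>\<^sub>i cnj (p(\<lambda>\<^sub>i))) c\<^sub>i\<close>. Since \<open>f \<mapsto> \<lambda> cnj f\<close> maps each of
  the monomials \<open>1, \<lambda>, \<bar>\<lambda>\<bar>\<^sup>2, \<lambda>\<bar>\<lambda>\<bar>\<^sup>2, \<dots>\<close> to the next, every \<open>p\<close> in \<open>polys_r2 (j - 1)\<close> yields
  an element \<open>L (p(\<lambda>) c)\<close> of the Krylov space. Its residual is \<open>X diag(q) X\<^sup>-\<^sup>1 b\<close> with
  \<open>q = \<kappa> p + \<lambda> cnj p - 1\<close>, because \<open>D\<close> commutes with \<open>diag(q)\<close>.
\<close>

text \<open>Coercivity reduces the search to a compact set: outside the ball of radius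
  \<open>A * f x0 + B\<close> every value of \<open>f\<close> exceeds \<open>f x0\<close>.\<close>

lemma continuous_coercive_attains_inf:
  fixes f :: "'a::euclidean_space \<Rightarrow> real"
  assumes "closed S" "S \<noteq> {}" "continuous_on S f"
    and coercive: "\<And>x. x \<in> S \<Longrightarrow> norm x \<le> A * f x + B" and "A \<ge> 0"
  shows "\<exists>x\<in>S. \<forall>y\<in>S. f x \<le> f y"
proof -
  obtain x0 where x0: "x0 \<in> S" using assms by blast
  define K where "K = S \<inter> cball 0 (A * f x0 + B)"
  have "compact K" unfolding K_def by (intro closed_Int_compact assms compact_cball)
  moreover have x0K: "x0 \<in> K" using x0 coercive by (auto simp: K_def)
  moreover have "continuous_on K f" by (rule continuous_on_subset[OF assms(3)]) (simp add: K_def)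
  ultimately obtain x where x: "x \<in> K" "\<forall>y\<in>K. f x \<le> f y"
    using continuous_attains_inf[of K f] by blast
  have "f x \<le> f y" if "y \<in> S" for y
  proof (cases "y \<in> K")
    case False
    then have "A * f x0 + B < norm y" using that by (auto simp: K_def)
    then have "A * f x0 < A * f y" using coercive[OF that] by linarith
    then have "f x0 < f y" using \<open>A \<ge> 0\<close> by (meson mult_left_mono not_le)
    then show ?thesis using x x0K by fastforce
  qed (use x in auto)
  then show ?thesis using x by (auto simp: K_def)
qed

section \<open>Inverses, entrywise conjugation and diagonal action of complex matrices\<close>

lemma matrix_inv_inverse:
  assumes "invertible A"
  shows "A ** matrix_inv A = mat 1" "matrix_inv A ** A = mat 1"
  using someI_ex[OF assms[unfolded invertible_def]] by (auto simp: matrix_inv_def)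

lemma cnj_vec_matrix_vector_mult: "cnj_vec (A *v v) = cnj_mat A *v cnj_vec v"
  by (simp add: matrix_vector_mult_def vec_eq_iff)

lemma cnj_mat_matrix_mult: "cnj_mat (A ** B) = cnj_mat A ** cnj_mat B"
  by (simp add: matrix_matrix_mult_def vec_eq_iff)

lemma cnj_mat_one: "cnj_mat (mat 1) = mat 1"
  by (simp add: mat_def vec_eq_iff)

lemma diagonal_matrix_mult_nth:
  assumes "diagonal_matrix A"
  shows "(A ** B) $ i $ k = A $ i $ i * B $ i $ k"
proof -
  have "(A ** B) $ i $ k = (\<Sum>l\<in>UNIV. if l = i then A $ i $ i * B $ i $ k else 0)"
    unfolding matrix_matrix_mult_def vec_lambda_beta
    using assms by (intro sum.cong) (auto simp: diagonal_matrix_def)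
  then show ?thesis by simp
qed

lemma diagonal_matrix_vector_mult_nth:
  assumes "diagonal_matrix A"
  shows "(A *v v) $ i = A $ i $ i * v $ i"
proof -
  have "(A *v v) $ i = (\<Sum>l\<in>UNIV. if l = i then A $ i $ i * v $ i else 0)"
    unfolding matrix_vector_mult_def vec_lambda_beta
    using assms by (intro sum.cong) (auto simp: diagonal_matrix_def)
  then show ?thesis by simp
qed

text \<open>The rules for \<open>onorm\<close> live on real normed spaces, so the matrix is viewed
  as a real linear map; finite dimension gives boundedness.\<close>

lemma bounded_linear_complex_matrix: "bounded_linear ((*v) (A :: complex ^ 'n ^ 'm))"
proof -
  have "linear ((*v) A)"
    by (intro linearI matrix_vector_right_distrib)
      (simp add: matrix_vector_mult_def vec_eq_iff scaleR_sum_right)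
  then show ?thesis by (rule linear_conv_bounded_linear[THEN iffD1])
qed

lemma norm_componentwise_mult_le:
  fixes v :: "complex ^ 'n"
  assumes "\<And>i. cmod (q i) \<le> B"
  shows "norm (\<chi> i. q i * v $ i) \<le> B * norm v"
proof -
  have "B \<ge> 0" using assms norm_ge_zero order_trans by blast
  have "norm (\<chi> i. q i * v $ i) \<le> L2_set (\<lambda>i. B * norm (v $ i)) UNIV"
    unfolding norm_vec_def
    by (rule L2_set_mono) (auto simp: norm_mult assms mult_right_mono)
  also have "\<dots> = B * norm v"
    using \<open>B \<ge> 0\<close> by (simp add: norm_vec_def L2_set_right_distrib)
  finally show ?thesis .
qed

section \<open>The real linear operator and its complex Krylov spaces\<close>

lemma real_lin_op_add: "real_lin_op \<kappa> M (x + y) = real_lin_op \<kappa> M x + real_lin_op \<kappa> M y"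
proof -
  have "cnj_vec (x + y) = cnj_vec x + cnj_vec y" by (simp add: vec_eq_iff)
  then show ?thesis
    by (simp only: real_lin_op_def matrix_vector_right_distrib) (simp add: vec.scale_right_distrib)
qed

text \<open>A scalar leaves the antilinear part conjugated but the shift unconjugated. The mismatch
  is only a multiple of \<open>x\<close>, which is harmless inside complex spans.\<close>

lemma real_lin_op_scale:
  "real_lin_op \<kappa> M (a *s x) = cnj a *s real_lin_op \<kappa> M x + ((a - cnj a) * \<kappa>) *s x"
proof -
  have "cnj_vec (a *s x) = cnj a *s cnj_vec x" by (simp add: vec_eq_iff)
  then have "real_lin_op \<kappa> M (a *s x) = \<kappa> *s (a *s x) + cnj a *s (M *v cnj_vec x)"
    by (simp only: real_lin_op_def vec.scale)
  then show ?thesis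
    by (simp add: real_lin_op_def vec_eq_iff algebra_simps)
qed

lemma scaleR_eq_vector_scalar_mult: "r *\<^sub>R (x :: complex ^ 'n) = of_real r *s x"
  by (simp add: vec_eq_iff scaleR_conv_of_real[where 'a = complex])

lemma linear_real_lin_op: "linear (real_lin_op \<kappa> M)"
  by (rule linearI) (simp_all add: real_lin_op_add real_lin_op_scale scaleR_eq_vector_scalar_mult)

lemma krylov_mono: "i \<le> j \<Longrightarrow> krylov i T b \<subseteq> krylov j T b"
  unfolding krylov_def by (rule vec.span_mono) auto

lemma subspace_krylov: "vec.subspace (krylov j T b)"
  by (simp add: krylov_def)

text \<open>Without complex linearity, the image of a combination of iterates involves, besides the
  next iterates, the iterates themselves; both kinds lie in the larger space.\<close>

lemma real_lin_op_krylov: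
  assumes "x \<in> krylov j (real_lin_op \<kappa> M) b"
  shows "real_lin_op \<kappa> M x \<in> krylov (Suc j) (real_lin_op \<kappa> M) b"
  using assms[unfolded krylov_def]
proof (induction rule: vec.span_induct_alt)
  case base
  have "real_lin_op \<kappa> M 0 = 0" by (rule linear_0[OF linear_real_lin_op])
  then show ?case by (simp add: vec.subspace_0[OF subspace_krylov])
next
  case (step a x y)
  then obtain i where i: "x = (real_lin_op \<kappa> M ^^ i) b" "i < j" by auto
  have "x \<in> krylov (Suc j) (real_lin_op \<kappa> M) b"
    unfolding krylov_def using i less_Suc_eq by (intro vec.span_base) blast
  moreover have "real_lin_op \<kappa> M x = (real_lin_op \<kappa> M ^^ Suc i) b" using i by simp
  then have "real_lin_op \<kappa> M x \<in> krylov (Suc j) (real_lin_op \<kappa> M) b"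
    unfolding krylov_def using i by (intro vec.span_base) blast
  ultimately show ?case
    using step.IH subspace_krylov[of "Suc j" "real_lin_op \<kappa> M" b]
    by (simp add: real_lin_op_add real_lin_op_scale vec.subspace_add vec.subspace_scale)
qed

section \<open>Monomials and linear structure of \<open>polys_r2\<close>\<close>

primrec r2_monom :: "nat \<Rightarrow> complex \<Rightarrow> complex" where
  "r2_monom 0 x = 1"
| "r2_monom (Suc m) x = x * cnj (r2_monom m x)"

text \<open>Two steps of the recursion multiply by \<open>x * cnj x\<close>, the squared
  modulus.\<close>

lemma r2_monom_even: "r2_monom (2 * k) x = of_real (cmod x ^ (2 * k))"
proof (induction k)
  case (Suc k)
  then show ?case
    using complex_norm_square[of x] by (simp add: power2_eq_square algebra_simps)
qed simp

lemma r2_monom_odd: "r2_monom (2 * k + 1) x = x * of_real (cmod x ^ (2 * k))"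
  by (simp add: r2_monom_even)

lemma polys_r2E:
  assumes "p \<in> polys_r2 J"
  obtains \<alpha> where
    "p = (\<lambda>x. \<Sum>k = 0..J div 2. (\<alpha> (2 * k) + \<alpha> (2 * k + 1) * x) * of_real (cmod x ^ (2 * k)))"
    "even J \<longrightarrow> \<alpha> (J + 1) = 0"
  using assms unfolding polys_r2_def by blast

lemma polys_r2_zero: "(\<lambda>x. 0) \<in> polys_r2 J"
  unfolding polys_r2_def by (rule CollectI, rule exI[of _ "\<lambda>_. 0"]) simp

lemma polys_r2_add:
  assumes "p \<in> polys_r2 J" "q \<in> polys_r2 J"
  shows "(\<lambda>x. p x + q x) \<in> polys_r2 J"
proof -
  obtain \<alpha> where \<alpha>:
    "p = (\<lambda>x. \<Sum>k = 0..J div 2. (\<alpha> (2 * k) + \<alpha> (2 * k + 1) * x) * of_real (cmod x ^ (2 * k)))"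
    "even J \<longrightarrow> \<alpha> (J + 1) = 0"
    using assms(1) by (rule polys_r2E)
  obtain \<beta> where \<beta>:
    "q = (\<lambda>x. \<Sum>k = 0..J div 2. (\<beta> (2 * k) + \<beta> (2 * k + 1) * x) * of_real (cmod x ^ (2 * k)))"
    "even J \<longrightarrow> \<beta> (J + 1) = 0"
    using assms(2) by (rule polys_r2E)
  show ?thesis unfolding polys_r2_def
    using \<alpha>(2) \<beta>(2)
    by (intro CollectI exI[of _ "\<lambda>m. \<alpha> m + \<beta> m"])
      (simp add: \<alpha>(1) \<beta>(1) sum.distrib[symmetric] algebra_simps)
qed

lemma polys_r2_scale:
  assumes "p \<in> polys_r2 J"
  shows "(\<lambda>x. a * p x) \<in> polys_r2 J"
proof -
  obtain \<alpha> where \<alpha>: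
    "p = (\<lambda>x. \<Sum>k = 0..J div 2. (\<alpha> (2 * k) + \<alpha> (2 * k + 1) * x) * of_real (cmod x ^ (2 * k)))"
    "even J \<longrightarrow> \<alpha> (J + 1) = 0"
    using assms(1) by (rule polys_r2E)
  show ?thesis unfolding polys_r2_def
    using \<alpha>(2)
    by (intro CollectI exI[of _ "\<lambda>m. a * \<alpha> m"])
      (simp add: \<alpha>(1) sum_distrib_left algebra_simps)
qed

section \<open>Attainment of the two minima\<close>

lemma krylov_minimizer:
  "\<exists>z. is_arg_min (\<lambda>z. norm (real_lin_op \<kappa> M z - b)) (\<lambda>z. z \<in> krylov j (real_lin_op \<kappa> M) b) z"
proof -
  \<comment> \<open>The minimum is sought over images rather than over \<open>z\<close>: the
    distance to \<open>b\<close> is coercive there even if the operator has a kernel. The image is a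
    real subspace, hence closed.\<close>
  define S where "S = real_lin_op \<kappa> M ` krylov j (real_lin_op \<kappa> M) b"
  have "subspace (krylov j (real_lin_op \<kappa> M) b)"
    using subspace_krylov[of j "real_lin_op \<kappa> M" b]
    by (intro subspaceI)
      (auto simp: scaleR_eq_vector_scalar_mult vec.subspace_0 vec.subspace_add vec.subspace_scale)
  then have S: "subspace S"
    unfolding S_def by (rule linear_subspace_image[OF linear_real_lin_op])
  have "norm x \<le> 1 * norm (x - b) + norm b" for x
    using norm_triangle_sub[of x b] by simp
  then obtain y where "y \<in> S" "\<forall>x\<in>S. norm (y - b) \<le> norm (x - b)"
    using continuous_coercive_attains_inf[of S "\<lambda>x. norm (x - b)" 1 "norm b"]
      closed_subspace[OF S] subspace_0[OF S]
    by (force intro: continuous_intros)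
  then show ?thesis unfolding S_def is_arg_min_def by force
qed

text \<open>The objective sees \<open>p\<close> only through the finite vector \<open>V p\<close>,
  which depends real linearly on \<open>p\<close>. So the problem is to find a point of a real
  subspace closest, in the maximum norm, to the all-ones vector.\<close>

lemma polys_r2_minimizer:
  fixes A :: "complex ^ 'n ^ 'n"
  assumes "diagonal_matrix A"
  shows "\<exists>p. is_arg_min (\<lambda>p. MAX \<mu> \<in> spectrum A. cmod (\<kappa> * p \<mu> + \<mu> * cnj (p \<mu>) - 1))
    (\<lambda>p. p \<in> polys_r2 J) p"
proof -
  define V :: "(complex \<Rightarrow> complex) \<Rightarrow> complex ^ 'n"
    where "V p = (\<chi> i. \<kappa> * p (A $ i $ i) + A $ i $ i * cnj (p (A $ i $ i)))" for p
  define f where "f v = (MAX i. cmod (v $ i - 1))" for v :: "complex ^ 'n"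
  have f: "(MAX \<mu> \<in> spectrum A. cmod (\<kappa> * p \<mu> + \<mu> * cnj (p \<mu>) - 1)) = f (V p)" for p
    by (simp add: spectrum_diagonal[OF assms] f_def V_def image_image)
  define S where "S = V ` polys_r2 J"
  have S: "subspace S"
  proof (rule subspaceI)
    have "V (\<lambda>x. 0) = 0" by (simp add: V_def vec_eq_iff)
    then show "0 \<in> S" unfolding S_def using polys_r2_zero by (metis imageI)
  next
    fix x y assume "x \<in> S" "y \<in> S"
    then obtain p q where pq: "p \<in> polys_r2 J" "q \<in> polys_r2 J" "x = V p" "y = V q"
      by (auto simp: S_def)
    then have "x + y = V (\<lambda>x. p x + q x)" by (simp add: V_def vec_eq_iff algebra_simps)
    then show "x + y \<in> S" unfolding S_def using polys_r2_add pq by blast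
  next
    fix r x assume "x \<in> S"
    then obtain p where p: "p \<in> polys_r2 J" "x = V p" by (auto simp: S_def)
    then have "r *\<^sub>R x = V (\<lambda>x. of_real r * p x)"
      by (simp add: V_def vec_eq_iff scaleR_conv_of_real[where 'a = complex] algebra_simps)
    then show "r *\<^sub>R x \<in> S" unfolding S_def using polys_r2_scale p by blast
  qed
  have f_ge: "cmod (v $ i - 1) \<le> f v" for v i
    unfolding f_def by (rule Max_ge) auto
  have coercive: "norm v \<le> real CARD('n) * f v + real CARD('n)" for v
  proof -
    have "norm v \<le> (\<Sum>i\<in>UNIV. cmod (v $ i))"
      unfolding norm_vec_def by (rule L2_set_le_sum) simp
    also have "\<dots> \<le> (\<Sum>i\<in>(UNIV :: 'n set). f v + 1)"
    proof (rule sum_mono)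
      fix i
      show "cmod (v $ i) \<le> f v + 1"
        using norm_triangle_sub[of "v $ i" 1] f_ge[of v i] by simp
    qed
    finally show ?thesis by (simp add: algebra_simps)
  qed
  \<comment> \<open>Continuity of the maximum comes from this Lipschitz bound.\<close>
  have f_Lipschitz: "\<bar>f v - f w\<bar> \<le> norm (v - w)" for v w
  proof -
    have *: "f v \<le> f w + norm (v - w)" for v w
    proof -
      have "cmod (v $ i - 1) \<le> f w + norm (v - w)" for i
        using norm_triangle_ineq[of "v $ i - w $ i" "w $ i - 1"] f_ge[of w i]
          Finite_Cartesian_Product.norm_nth_le[of "v - w" i] by simp
      then show ?thesis unfolding f_def[of v] by (subst Max_le_iff) auto
    qed
    show ?thesis using *[of v w] *[of w v] by (simp add: norm_minus_commute abs_le_iff)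
  qed
  have "continuous_on S f"
    unfolding continuous_on_iff dist_norm real_norm_def
    using f_Lipschitz order.strict_trans1 by meson
  then obtain v where "v \<in> S" "\<forall>w\<in>S. f v \<le> f w"
    using continuous_coercive_attains_inf[of S f "real CARD('n)" "real CARD('n)"]
      closed_subspace[OF S] subspace_0[OF S] coercive by fastforce
  then show ?thesis unfolding f S_def is_arg_min_def by force
qed

text \<open>Witnesses for \<open>is_arg_min\<close> make attainment of both minima part of the
  claim. All minimizers share one value, so the inequality does not depend on the choice.\<close>

theorem theorem2p5:
  fixes M X \<Lambda> D :: "complex ^ 'n ^ 'n" and \<kappa> :: complex and b :: "complex ^ 'n" and j :: nat
  defines "D' \<equiv> matrix_inv D ** \<Lambda> ** cnj_mat D"
  defines "resid \<equiv> (\<lambda>z. norm (real_lin_op \<kappa> M z - b))"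
  defines "bound \<equiv> (\<lambda>p. MAX \<mu> \<in> spectrum D'. cmod (\<kappa> * p \<mu> + \<mu> * cnj (p \<mu>) - 1))"
  assumes "j \<ge> 1"
    and "invertible X" and "diagonal_matrix \<Lambda>"
    and "M = X ** \<Lambda> ** cnj_mat (matrix_inv X)"
    and "unitary_matrix D" and "diagonal_matrix D"
    and "\<forall>i. (matrix_inv D *v (matrix_inv X *v b)) $ i \<in> \<real>"
  shows "\<exists>z p. is_arg_min resid (\<lambda>z. z \<in> krylov j (real_lin_op \<kappa> M) b) z
           \<and> is_arg_min bound (\<lambda>p. p \<in> polys_r2 (j - 1)) p
           \<and> resid z \<le> cond2 X * bound p * norm b"
proof -
  define c where "c = matrix_inv D *v (matrix_inv X *v b)"
  define L where "L y = X *v (D *v y)" for y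
  define lam where "lam i = D' $ i $ i" for i
  have invX: "X ** matrix_inv X = mat 1" "matrix_inv X ** X = mat 1"
    using matrix_inv_inverse[OF \<open>invertible X\<close>] by auto
  have "invertible D" using \<open>unitary_matrix D\<close> unfolding unitary_matrix_def invertible_def by blast
  then have invD: "D ** matrix_inv D = mat 1" "matrix_inv D ** D = mat 1"
    using matrix_inv_inverse by auto
  have Dc: "D *v c = matrix_inv X *v b" by (simp add: c_def matrix_vector_mul_assoc matrix_mul_assoc invD)
  have Lc: "L c = b" by (simp add: L_def Dc matrix_vector_mul_assoc invX)
  have c_real: "cnj (c $ i) = c $ i" for i
    using assms(10) by (simp add: c_def Reals_cnj_iff)
  \<comment> \<open>In this form the entries of \<open>D'\<close> can be read off by cancelling
    those of \<open>D\<close>, without computing \<open>matrix_inv D\<close>.\<close>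
  have DD': "D ** D' = \<Lambda> ** cnj_mat D"
    by (simp add: D'_def matrix_mul_assoc invD)
  have D_nz: "D $ i $ i \<noteq> 0" for i
  proof
    assume "D $ i $ i = 0"
    then have "(D ** matrix_inv D) $ i $ i = 0"
      by (simp add: diagonal_matrix_mult_nth[OF \<open>diagonal_matrix D\<close>])
    then show False by (simp add: invD mat_def)
  qed
  have D'_nth: "D $ i $ i * D' $ i $ k = \<Lambda> $ i $ i * cnj (D $ i $ k)" for i k
  proof -
    have "(D ** D') $ i $ k = (\<Lambda> ** cnj_mat D) $ i $ k" by (simp only: DD')
    then show ?thesis
      by (simp add: diagonal_matrix_mult_nth \<open>diagonal_matrix D\<close> \<open>diagonal_matrix \<Lambda>\<close>)
  qed
  have diag: "diagonal_matrix D'"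
    unfolding diagonal_matrix_def
  proof (intro allI impI)
    fix i k :: 'n assume "i \<noteq> k"
    then have "D $ i $ k = 0" using \<open>diagonal_matrix D\<close> by (simp add: diagonal_matrix_def)
    then show "D' $ i $ k = 0" using D'_nth[of i k] D_nz[of i] by simp
  qed
  have L_add: "L (x + y) = L x + L y" and L_diff: "L (x - y) = L x - L y"
    and L_scale: "L (a *s x) = a *s L x" for a x y
    by (simp_all add: L_def matrix_vector_right_distrib matrix_vector_mult_diff_distrib vec.scale)
  \<comment> \<open>The conjugated inverse in \<open>M\<close> cancels the \<open>cnj_mat X\<close>
    produced by conjugating \<open>L y\<close>; the remaining \<open>\<Lambda> ** cnj_mat D\<close>
    is \<open>D ** D'\<close>, which puts \<open>D\<close> back in front.\<close>
  have op_L: "real_lin_op \<kappa> M (L y) = L (\<chi> i. \<kappa> * y $ i + lam i * cnj (y $ i))" for y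
  proof -
    have "M *v cnj_vec (L y) = X *v (\<Lambda> *v (cnj_mat (matrix_inv X) *v (cnj_mat X *v cnj_vec (D *v y))))"
      unfolding L_def cnj_vec_matrix_vector_mult[of X] assms(7)
      by (simp only: matrix_vector_mul_assoc matrix_mul_assoc)
    also have "cnj_mat (matrix_inv X) *v (cnj_mat X *v cnj_vec (D *v y)) = cnj_vec (D *v y)"
      unfolding matrix_vector_mul_assoc cnj_mat_matrix_mult[symmetric] invX cnj_mat_one by simp
    also have "\<Lambda> *v cnj_vec (D *v y) = D *v (\<chi> i. lam i * cnj (y $ i))"
      using D'_nth
      by (simp add: vec_eq_iff diagonal_matrix_vector_mult_nth \<open>diagonal_matrix D\<close>
          \<open>diagonal_matrix \<Lambda>\<close> lam_def mult.assoc[symmetric])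
    finally have "real_lin_op \<kappa> M (L y) = L (\<kappa> *s y + (\<chi> i. lam i * cnj (y $ i)))"
      unfolding real_lin_op_def L_add L_scale by (simp add: L_def)
    also have "\<kappa> *s y + (\<chi> i. lam i * cnj (y $ i)) = (\<chi> i. \<kappa> * y $ i + lam i * cnj (y $ i))"
      by (simp add: vec_eq_iff)
    finally show ?thesis .
  qed

  define E where "E m = L (\<chi> i. r2_monom m (lam i) * c $ i)" for m
  \<comment> \<open>Subtracting the shift isolates the antilinear part. Since \<open>c\<close> is
    real, conjugation affects only the monomial and moves it to the next one.\<close>
  have E_Suc: "E (Suc m) = real_lin_op \<kappa> M (E m) - \<kappa> *s E m" for m
  proof -
    have "real_lin_op \<kappa> M (E m) - \<kappa> *s E m = L ((\<chi> i. \<kappa> * (r2_monom m (lam i) * c $ i)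
      + lam i * cnj (r2_monom m (lam i) * c $ i)) - \<kappa> *s (\<chi> i. r2_monom m (lam i) * c $ i))"
      unfolding E_def op_L L_diff L_scale by simp
    also have "\<dots> = E (Suc m)"
      unfolding E_def by (rule arg_cong[of _ _ L]) (simp add: vec_eq_iff c_real)
    finally show ?thesis by simp
  qed
  have E_krylov: "E m \<in> krylov (Suc m) (real_lin_op \<kappa> M) b" for m
  proof (induction m)
    case 0
    have "E 0 = (real_lin_op \<kappa> M ^^ 0) b" by (simp add: E_def Lc)
    then show ?case unfolding krylov_def by (intro vec.span_base) blast
  next
    case (Suc m)
    moreover have "E m \<in> krylov (Suc (Suc m)) (real_lin_op \<kappa> M) b"
      using Suc krylov_mono[of "Suc m" "Suc (Suc m)"] by fastforce
    ultimately show ?case unfolding E_Suc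
      by (intro vec.subspace_diff vec.subspace_scale subspace_krylov real_lin_op_krylov)
  qed
  have poly_krylov: "L (\<chi> i. p (lam i) * c $ i) \<in> krylov j (real_lin_op \<kappa> M) b"
    if p_in: "p \<in> polys_r2 (j - 1)" for p
  proof -
    obtain \<alpha> where p:
        "p = (\<lambda>x. \<Sum>k = 0..(j - 1) div 2. (\<alpha> (2 * k) + \<alpha> (2 * k + 1) * x) * of_real (cmod x ^ (2 * k)))"
      and \<alpha>: "even (j - 1) \<longrightarrow> \<alpha> (j - 1 + 1) = 0"
      using p_in by (rule polys_r2E)
    \<comment> \<open>Monomials are grouped in pairs to match the sum defining
      \<open>polys_r2\<close>.\<close>
    define G where "G k = (\<chi> i. (\<alpha> (2 * k) * r2_monom (2 * k) (lam i)
      + \<alpha> (2 * k + 1) * r2_monom (2 * k + 1) (lam i)) * c $ i)" for k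
    have LG: "L (G k) = \<alpha> (2 * k) *s E (2 * k) + \<alpha> (2 * k + 1) *s E (2 * k + 1)" for k
      unfolding E_def L_add[symmetric] L_scale[symmetric] G_def
      by (rule arg_cong[of _ _ L]) (simp add: vec_eq_iff algebra_simps)
    have "(\<chi> i. p (lam i) * c $ i) = (\<Sum>k = 0..(j - 1) div 2. G k)"
      unfolding p G_def r2_monom_even r2_monom_odd
      by (simp add: vec_eq_iff sum_distrib_right) (intro allI sum.cong; simp add: algebra_simps)
    moreover have "L (sum G K) = (\<Sum>k\<in>K. L (G k))" for K
      by (simp add: L_def vec.sum)
    moreover have "L (G k) \<in> krylov j (real_lin_op \<kappa> M) b" if k: "k \<in> {0..(j - 1) div 2}" for k
    proof -
      have E_j: "E m \<in> krylov j (real_lin_op \<kappa> M) b" if "m < j" for m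
        using E_krylov[of m] krylov_mono[of "Suc m" j] that by fastforce
      have "2 * k < j" using k \<open>j \<ge> 1\<close> by auto
      moreover have "\<alpha> (2 * k + 1) *s E (2 * k + 1) \<in> krylov j (real_lin_op \<kappa> M) b"
      \<comment> \<open>The odd index can overshoot only in the last pair, when \<open>j - 1\<close>
        is even; this is exactly where \<open>polys_r2\<close> forces the coefficient
        \<open>\<alpha> j\<close> to vanish.\<close>
      proof (cases "2 * k + 1 < j")
        case False
        then have "j = 2 * k + 1" using \<open>2 * k < j\<close> by linarith
        then have "\<alpha> (2 * k + 1) = 0" using \<alpha> by simp
        then show ?thesis by (simp add: vec.subspace_0 subspace_krylov)
      qed (use E_j in \<open>simp add: vec.subspace_scale subspace_krylov\<close>)
      ultimately show ?thesis
        unfolding LG using E_j by (simp add: vec.subspace_add vec.subspace_scale subspace_krylov)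
    qed
    ultimately show ?thesis by (simp only:) (intro vec.subspace_sum subspace_krylov)
  qed

  have resid_bound: "resid (L (\<chi> i. p (lam i) * c $ i)) \<le> cond2 X * bound p * norm b" for p
  proof -
    define q where "q i = \<kappa> * p (lam i) + lam i * cnj (p (lam i)) - 1" for i
    have q_le: "cmod (q i) \<le> bound p" for i
      unfolding bound_def q_def spectrum_diagonal[OF diag] lam_def by (rule Max_ge) auto
    then have "bound p \<ge> 0" using norm_ge_zero order_trans by blast
    define w where "w = matrix_inv X *v b"
    \<comment> \<open>Here \<open>D\<close> is absorbed into \<open>D *v c\<close>, which is
      \<open>matrix_inv X *v b\<close>, before any norm is taken; hence only the condition number of
      \<open>X\<close> appears.\<close>
    have "D *v ((\<chi> i. \<kappa> * (p (lam i) * c $ i) + lam i * cnj (p (lam i) * c $ i)) - c)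
      = (\<chi> i. q i * (D *v c) $ i)"
      by (simp add: vec_eq_iff diagonal_matrix_vector_mult_nth \<open>diagonal_matrix D\<close> c_real q_def
          algebra_simps)
    moreover have "real_lin_op \<kappa> M (L (\<chi> i. p (lam i) * c $ i)) - b
      = L ((\<chi> i. \<kappa> * (p (lam i) * c $ i) + lam i * cnj (p (lam i) * c $ i)) - c)"
      unfolding op_L L_diff Lc by simp
    ultimately have "resid (L (\<chi> i. p (lam i) * c $ i)) = norm (X *v (\<chi> i. q i * w $ i))"
      unfolding resid_def w_def by (simp add: L_def Dc)
    also have "\<dots> \<le> onorm ((*v) X) * norm (\<chi> i. q i * w $ i)"
      by (rule onorm[OF bounded_linear_complex_matrix])
    also have "\<dots> \<le> onorm ((*v) X) * (bound p * norm w)"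
      by (intro mult_left_mono norm_componentwise_mult_le q_le onorm_pos_le bounded_linear_complex_matrix)
    also have "\<dots> \<le> onorm ((*v) X) * (bound p * (onorm ((*v) (matrix_inv X)) * norm b))"
      unfolding w_def using \<open>bound p \<ge> 0\<close>
      by (intro mult_left_mono onorm onorm_pos_le bounded_linear_complex_matrix) auto
    finally show ?thesis by (simp add: cond2_def mult_ac)
  qed

  obtain z where z: "is_arg_min resid (\<lambda>z. z \<in> krylov j (real_lin_op \<kappa> M) b) z"
    unfolding resid_def using krylov_minimizer by blast
  obtain p where p: "is_arg_min bound (\<lambda>p. p \<in> polys_r2 (j - 1)) p"
    unfolding bound_def using polys_r2_minimizer[OF diag] by blast
  \<comment> \<open>The optimal \<open>p\<close> supplies one competitor in the Krylov space, which
    the minimizer \<open>z\<close> cannot exceed in residual.\<close>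
  have "resid z \<le> resid (L (\<chi> i. p (lam i) * c $ i))"
    using z p poly_krylov by (auto simp: is_arg_min_def not_less)
  then show ?thesis using z p resid_bound order_trans by blast
qed

end
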